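(* Let $D$ be a division ring with center $F$, and let $n\ge2$ be an integer such that either (i) the field $F$ has at least three elements, or (ii) the field $F$ has exactly two elements and $n$ is odd. If every nonzero element of $D$ can be expressed as a product of two noncentral commutators in $D$, then any matrix in $\mathrm{M}_n(D)$ can be written as a product of two commutators in $\mathrm{M}_n(D)$.
   Context: $\mathrm{M}_n(D)$ is the ring of $n\times n$ matrices over $D$. A commutator in a ring $S$ is an element $[a,b]=ab-ba$ with $a,b\in S$. A commutator in $D$ is noncentral if it does not belong to the center $F$ of $D$. *)

theory Defs
  imports "Jordan_Normal_Form.Matrix"
begin

definition ring_center :: "'a::ring_1 set" where
  "ring_center = {z. \<forall>x. z * x = x * z}"

(* The carrier S is explicit because the n-by-n matrices form only a part
   of the type 'a mat, namely carrier_mat n n. *)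
definition commutators :: "'s::{times,minus} set \<Rightarrow> 's set" where
  "commutators S = {a * b - b * a | a b. a \<in> S \<and> b \<in> S}"

definition noncentral_commutators :: "'a::ring_1 set" where
  "noncentral_commutators = commutators UNIV - ring_center"

end

theory Submission
  imports Defs "HOL-Combinatorics.Permutations"
begin

text \<open>Central matrices split as products of scalar matrices, and a noncentral two-by-two matrix is
  similar to the product of an off-diagonal matrix and a triangular matrix with diagonal \<open>1, -1\<close>.
  A noncentral matrix of larger size is similar to a product \<open>L U\<close> of a lower and an upper
  triangular matrix in which all pivots but the last can be prescribed (Sourour's theorem). Take
  the first pivots to be squares \<open>l\<^sub>i * l\<^sub>i\<close> of nonzero elements with sum zero and distribute them
  evenly over \<open>L\<close> and \<open>U\<close>; the last pivot is a product of two commutators of \<open>D\<close>. So \<open>L\<close> and \<open>U\<close>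
  consist of a triangular block of trace zero, which is a commutator with a nilpotent shift, and
  a corner that is a commutator. Such a matrix is a commutator, because Sylvester's equation for a
  nilpotent block and a nonzero scalar is solvable.\<close>

section \<open>Commutators of matrices under conjugation\<close>

lemma commutatorsI: "a \<in> S \<Longrightarrow> b \<in> S \<Longrightarrow> a * b - b * a \<in> commutators S"
  unfolding commutators_def by blast

lemma add_diff_cancel_mat:
  fixes A :: "'a::ring_1 mat"
  assumes "A \<in> carrier_mat n m" "B \<in> carrier_mat n m"
  shows "A + B - B = A"
  using assms by (intro eq_matI) auto

lemma conj_minus_mat:
  fixes A :: "'a::ring_1 mat"
  assumes "P \<in> carrier_mat n n" "Q \<in> carrier_mat n n" "A \<in> carrier_mat n n" "B \<in> carrier_mat n n"
  shows "P * (A - B) * Q = P * A * Q - P * B * Q"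
  using assms by (simp add: mult_minus_distrib_mat[of _ n n _ n] minus_mult_distrib_mat[of _ n n _ _ n])

lemma conj_mult_mat:
  fixes A :: "'a::ring_1 mat"
  assumes c: "P \<in> carrier_mat n n" "Q \<in> carrier_mat n n" "A \<in> carrier_mat n n" "B \<in> carrier_mat n n"
    and QP: "Q * P = 1\<^sub>m n"
  shows "P * (A * B) * Q = (P * A * Q) * (P * B * Q)"
proof -
  have "(P * A * Q) * (P * B * Q) = P * A * (Q * (P * B * Q))"
    using c by (intro assoc_mult_mat) auto
  also have "Q * (P * B * Q) = Q * P * (B * Q)"
    using c by (simp add: assoc_mult_mat[of _ n n _ n _ n])
  also have "\<dots> = B * Q" using c by (simp add: QP)
  finally show ?thesis using c by (simp add: assoc_mult_mat[of _ n n _ n _ n])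
qed

lemma conj_commutators:
  fixes X :: "'a::ring_1 mat"
  assumes c: "P \<in> carrier_mat n n" "Q \<in> carrier_mat n n" and QP: "Q * P = 1\<^sub>m n"
    and X: "X \<in> commutators (carrier_mat n n)"
  shows "P * X * Q \<in> commutators (carrier_mat n n)"
proof -
  from X obtain a b where ab: "a \<in> carrier_mat n n" "b \<in> carrier_mat n n" "X = a * b - b * a"
    unfolding commutators_def by blast
  have "P * X * Q = (P * a * Q) * (P * b * Q) - (P * b * Q) * (P * a * Q)"
    using c ab QP by (simp add: conj_minus_mat[of _ n] conj_mult_mat[of _ n])
  then show ?thesis using c ab by (auto intro!: commutatorsI)
qed

lemma commutators_carrier_mat:
  "X \<in> commutators (carrier_mat n n) \<Longrightarrow> X \<in> carrier_mat n n"
  unfolding commutators_def by auto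

text \<open>Conjugation is multiplicative, so it acts on each factor separately and keeps it a
  commutator. Hence it suffices to factor one representative of a similarity class.\<close>

lemma prod_commutators_similar:
  fixes X :: "'a::ring_1 mat"
  assumes sim: "similar_mat A (X * Y)" and A: "A \<in> carrier_mat n n"
    and X: "X \<in> commutators (carrier_mat n n)" and Y: "Y \<in> commutators (carrier_mat n n)"
  shows "\<exists>X \<in> commutators (carrier_mat n n). \<exists>Y \<in> commutators (carrier_mat n n). A = X * Y"
proof -
  obtain P Q where w: "similar_mat_wit A (X * Y) P Q" using sim unfolding similar_mat_def by blast
  note D = similar_mat_witD2[OF A w]
  have "A = (P * X * Q) * (P * Y * Q)"
    using D conj_mult_mat[OF D(6,7) commutators_carrier_mat[OF X] commutators_carrier_mat[OF Y] D(2)] by simp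
  then show ?thesis using conj_commutators[OF D(6,7,2)] X Y by blast
qed

text \<open>Relabelling the basis is conjugation by a permutation matrix. It serves to move a chosen
  entry to a fixed place and to reverse the order of the basis.\<close>

lemma similar_mat_permute:
  fixes A :: "'a::ring_1 mat"
  assumes A: "A \<in> carrier_mat n n" and f: "f permutes {..<n}"
  shows "similar_mat A (mat n n (\<lambda>(i,j). A $$ (f i, f j)))"
proof -
  define P where "P = (mat n n (\<lambda>(i,j). if i = f j then 1 else 0) :: 'a mat)"
  define Q where "Q = (mat n n (\<lambda>(i,j). if f i = j then 1 else 0) :: 'a mat)"
  define B where "B = mat n n (\<lambda>(i,j). A $$ (f i, f j))"
  have fl: "f i < n \<longleftrightarrow> i < n" for i using permutes_in_image[OF f] by simp
  have inj: "f i = f j \<longleftrightarrow> i = j" for i j using permutes_inj[OF f] by (auto dest: injD)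
  have ex: "\<exists>k<n. i = f k" if "i < n" for i
    using that permutes_image[OF f] by auto
  have c: "P \<in> carrier_mat n n" "Q \<in> carrier_mat n n" "B \<in> carrier_mat n n"
    unfolding P_def Q_def B_def by auto
  have PQ: "P * Q = 1\<^sub>m n"
  proof (rule eq_matI)
    fix i j assume ij: "i < dim_row (1\<^sub>m n :: 'a mat)" "j < dim_col (1\<^sub>m n :: 'a mat)"
    obtain k where k: "k < n" "i = f k" using ex ij by auto
    have "(P * Q) $$ (i,j) = (\<Sum>l\<in>{0..<n}. (if i = f l then 1 else 0) * (if f l = j then 1 else 0))"
      using ij unfolding P_def Q_def by (simp add: scalar_prod_def)
    also have "\<dots> = (\<Sum>l\<in>{0..<n}. if l = k then (if f l = j then 1 else 0) else 0)"
      using k by (intro sum.cong) (auto simp: inj)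
    finally have "(P * Q) $$ (i,j) = \<dots>" .
    then show "(P * Q) $$ (i,j) = 1\<^sub>m n $$ (i,j)" using k ij by auto
  qed (use c in auto)
  have QP: "Q * P = 1\<^sub>m n"
  proof (rule eq_matI)
    fix i j assume ij: "i < dim_row (1\<^sub>m n :: 'a mat)" "j < dim_col (1\<^sub>m n :: 'a mat)"
    have "(Q * P) $$ (i,j) = (\<Sum>l\<in>{0..<n}. (if f i = l then 1 else 0) * (if l = f j then 1 else 0))"
      using ij unfolding P_def Q_def by (simp add: scalar_prod_def)
    also have "\<dots> = (\<Sum>l\<in>{0..<n}. if l = f i then (if l = f j then 1 else 0) else 0)"
      by (intro sum.cong) auto
    finally have "(Q * P) $$ (i,j) = \<dots>" .
    then show "(Q * P) $$ (i,j) = 1\<^sub>m n $$ (i,j)" using ij by (auto simp: fl inj)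
  qed (use c in auto)
  have AP: "A * P = P * B"
  proof (rule eq_matI)
    fix i j assume "i < dim_row (P * B)" "j < dim_col (P * B)"
    then have ij: "i < n" "j < n" using c by auto
    obtain k where k: "k < n" "i = f k" using ex ij by auto
    have "(A * P) $$ (i,j) = (\<Sum>l\<in>{0..<n}. A $$ (i,l) * (if l = f j then 1 else 0))"
      using ij A unfolding P_def by (simp add: scalar_prod_def)
    also have "\<dots> = (\<Sum>l\<in>{0..<n}. if l = f j then A $$ (i,l) else 0)"
      by (intro sum.cong) auto
    finally have "(A * P) $$ (i,j) = \<dots>" .
    moreover have "(P * B) $$ (i,j) = (\<Sum>l\<in>{0..<n}. (if i = f l then 1 else 0) * A $$ (f l, f j))"
      using ij unfolding P_def B_def by (simp add: scalar_prod_def)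
    then have "(P * B) $$ (i,j) = (\<Sum>l\<in>{0..<n}. if l = k then A $$ (f l, f j) else 0)"
      unfolding k(2) inj by (simp add: if_distrib[of "\<lambda>x. x * _"] eq_commute[of k] cong: if_cong)
    ultimately show "(A * P) $$ (i,j) = (P * B) $$ (i,j)" using ij k by (auto simp: fl)
  qed (use c A in auto)
  have "A = A * (P * Q)" using A PQ by simp
  also have "\<dots> = A * P * Q" using A c by (simp add: assoc_mult_mat[of _ n n _ n _ n])
  finally show ?thesis
    using A c PQ QP by (intro similar_matI[of _ _ P Q n]) (auto simp: AP B_def)
qed

section \<open>Sylvester's equation with a nilpotent coefficient\<close>

text \<open>Sylvester's equation is solvable here because the spectra of a nilpotent matrix and of a
  unit are disjoint.\<close>

lemma sylvester_nilpotent_col: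
  fixes M :: "'a::ring_1 mat"
  assumes M: "M \<in> carrier_mat n n" and U: "U \<in> carrier_mat m m" "V \<in> carrier_mat m m" "V * U = 1\<^sub>m m" "U * V = 1\<^sub>m m"
    and w: "w \<in> carrier_mat n m" and nil: "M ^\<^sub>m k * w = 0\<^sub>m n m"
  shows "\<exists>z \<in> carrier_mat n m. z * U - M * z = w"
  using w nil
proof (induction k arbitrary: w)
  case 0
  then have "w = 0\<^sub>m n m" using M by simp
  then show ?case using M U by (intro bexI[of _ "0\<^sub>m n m"]) auto
next
  case (Suc k)
  have "M ^\<^sub>m k * (M * w) = 0\<^sub>m n m"
    using Suc.prems M by (simp add: assoc_mult_mat[of _ n n _ n _ m])
  then obtain z where z: "z \<in> carrier_mat n m" "z * U - M * z = M * w"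
    using Suc.IH[of "M * w"] Suc.prems M by auto
  \<comment> \<open>The equation for \<open>z\<close> says \<open>z * U = M * w + M * z\<close>, so
    multiplying by \<open>V\<close> gives \<open>z = M * z'\<close>, while
    \<open>z' * U = w + z\<close>. Unrolled, the solution is the finite geometric series with terms
    \<open>M ^\<^sub>m i * w * V ^\<^sub>m (i + 1)\<close>.\<close>
  define z' where "z' = (w + z) * V"
  have c: "z' \<in> carrier_mat n m" unfolding z'_def using Suc.prems z U by auto
  have "z' * U = w + z"
    unfolding z'_def using Suc.prems z U by (simp add: assoc_mult_mat[of _ n m _ m _ m])
  moreover have "M * z' = z"
  proof -
    have "M * w + M * z = z * U"
      unfolding z(2)[symmetric] using z(1) M U by (intro eq_matI) auto
    then have "M * z' = z * U * V"
      unfolding z'_def using Suc.prems z U M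
      by (simp add: assoc_mult_mat[of _ n n _ m _ m, symmetric] mult_add_distrib_mat[of _ n n _ m])
    then show ?thesis using z U by (simp add: assoc_mult_mat[of _ n m _ m _ m])
  qed
  ultimately have "z' * U - M * z' = w"
    using Suc.prems(1) z(1) by (simp add: add_diff_cancel_mat)
  with c show ?case by blast
qed

text \<open>The mirror image of the column case. Transposition does not reverse products over a
  noncommutative ring, so the induction is run again with \<open>w * M\<close> in place of
  \<open>M * w\<close>.\<close>

lemma sylvester_nilpotent_row:
  fixes M :: "'a::ring_1 mat"
  assumes M: "M \<in> carrier_mat n n" and U: "U \<in> carrier_mat m m" "V \<in> carrier_mat m m" "V * U = 1\<^sub>m m" "U * V = 1\<^sub>m m"
    and w: "w \<in> carrier_mat m n" and nil: "w * M ^\<^sub>m k = 0\<^sub>m m n"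
  shows "\<exists>z \<in> carrier_mat m n. U * z - z * M = w"
  using w nil
proof (induction k arbitrary: w)
  case 0
  then have "w = 0\<^sub>m m n" using M by simp
  then show ?case using M U by (intro bexI[of _ "0\<^sub>m m n"]) auto
next
  case (Suc k)
  \<comment> \<open>Matrix powers grow on the right, but here the factor next to \<open>w\<close>
    has to be split off.\<close>
  have "M ^\<^sub>m Suc k = M * M ^\<^sub>m k"
  proof (induction k)
    case (Suc k)
    then have "M ^\<^sub>m Suc (Suc k) = M * M ^\<^sub>m k * M" by simp
    then show ?case using M by (simp add: assoc_mult_mat[of _ n n _ n _ n])
  qed (use M in auto)
  then have "(w * M) * M ^\<^sub>m k = 0\<^sub>m m n"
    using Suc.prems M by (simp add: assoc_mult_mat[of _ m n _ n _ n])
  then obtain z where z: "z \<in> carrier_mat m n" "U * z - z * M = w * M"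
    using Suc.IH[of "w * M"] Suc.prems M by auto
  define z' where "z' = V * (w + z)"
  have c: "z' \<in> carrier_mat m n" unfolding z'_def using Suc.prems z U by auto
  have "U * z' = w + z"
    unfolding z'_def using Suc.prems z U by (simp add: assoc_mult_mat[of _ m m _ m _ n, symmetric])
  moreover have "z' * M = z"
  proof -
    have "w * M + z * M = U * z"
      unfolding z(2)[symmetric] using z(1) M U by (intro eq_matI) auto
    then have "z' * M = V * (U * z)"
      unfolding z'_def using Suc.prems z U M
      by (simp add: assoc_mult_mat[of _ m m _ n _ n] add_mult_distrib_mat[of _ m n _ _ n])
    then show ?thesis using z U by (simp add: assoc_mult_mat[of _ m m _ m _ n, symmetric])
  qed
  ultimately have "U * z' - z' * M = w"
    using Suc.prems(1) z(1) by (simp add: add_diff_cancel_mat)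
  with c show ?case by blast
qed

section \<open>Triangular matrices of trace zero\<close>

text \<open>The nilpotent factor is recorded because a corner is added later: extending such a
  commutator by a block leads to Sylvester's equation, which is solved by means of the
  nilpotence.\<close>

definition nil_commutators :: "nat \<Rightarrow> 'a::ring_1 mat set" where
  "nil_commutators n = {M * Y - Y * M | M Y. M \<in> carrier_mat n n \<and> Y \<in> carrier_mat n n
     \<and> (\<exists>k. M ^\<^sub>m k = 0\<^sub>m n n)}"

lemma nil_commutators_subset: "nil_commutators n \<subseteq> commutators (carrier_mat n n)"
  unfolding nil_commutators_def commutators_def by blast

lemma similar_mat_carrier:
  assumes "similar_mat A B" and "B \<in> carrier_mat n n"
  shows "A \<in> carrier_mat n n"
  using similar_matD[OF assms(1)] assms(2) by auto

lemma nil_commutators_similar: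
  fixes A :: "'a::ring_1 mat"
  assumes sim: "similar_mat A B" and B: "B \<in> nil_commutators n"
  shows "A \<in> nil_commutators n"
proof -
  obtain M Y k where M: "M \<in> carrier_mat n n" "Y \<in> carrier_mat n n" "M ^\<^sub>m k = 0\<^sub>m n n" "B = M * Y - Y * M"
    using B unfolding nil_commutators_def by blast
  have Bc: "B \<in> carrier_mat n n" using M by auto
  have A: "A \<in> carrier_mat n n" using similar_mat_carrier[OF sim Bc] .
  obtain P Q where w: "similar_mat_wit A B P Q" using sim unfolding similar_mat_def by blast
  note D = similar_mat_witD2[OF A w]
  have "A = (P * M * Q) * (P * Y * Q) - (P * Y * Q) * (P * M * Q)"
    using D M by (simp add: conj_minus_mat[of _ n] conj_mult_mat[of _ n])
  moreover have "similar_mat_wit (P * M * Q) M P Q"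
    using D M by (intro similar_mat_witI[where n = n]) auto
  then have "(P * M * Q) ^\<^sub>m k = 0\<^sub>m n n"
    using similar_mat_wit_pow_id[of _ _ P Q k] D M by simp
  moreover have "P * M * Q \<in> carrier_mat n n" "P * Y * Q \<in> carrier_mat n n" using D M by auto
  ultimately show ?thesis unfolding nil_commutators_def by blast
qed

text \<open>The nilpotent Jordan block. From the left it moves rows up by one, from the right it
  moves columns one to the right.\<close>

definition shift_mat :: "nat \<Rightarrow> 'a::ring_1 mat" where
  "shift_mat n = mat n n (\<lambda>(i,j). if j = Suc i then 1 else 0)"

lemma shift_mat_carrier: "shift_mat n \<in> carrier_mat n n"
  unfolding shift_mat_def by simp

lemma shift_mat_mult:
  assumes Y: "Y \<in> carrier_mat n n" and ij: "i < n" "j < n"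
  shows "(shift_mat n * Y) $$ (i,j) = (if Suc i < n then Y $$ (Suc i, j) else 0)"
proof -
  have "(shift_mat n * Y) $$ (i,j) = (\<Sum>l\<in>{0..<n}. (if l = Suc i then 1 else 0) * Y $$ (l,j))"
    using Y ij unfolding shift_mat_def by (simp add: scalar_prod_def)
  also have "\<dots> = (\<Sum>l\<in>{0..<n}. if l = Suc i then Y $$ (l,j) else 0)"
    by (intro sum.cong) auto
  finally show ?thesis by simp
qed

lemma mult_shift_mat:
  assumes Y: "Y \<in> carrier_mat n n" and ij: "i < n" "j < n"
  shows "(Y * shift_mat n) $$ (i,j) = (if 0 < j then Y $$ (i, j - 1) else 0)"
proof -
  have "(Y * shift_mat n) $$ (i,j) = (\<Sum>l\<in>{0..<n}. Y $$ (i,l) * (if j = Suc l then 1 else 0))"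
    using Y ij unfolding shift_mat_def by (simp add: scalar_prod_def)
  also have "\<dots> = (\<Sum>l\<in>{0..<n}. if l = j - 1 then (if 0 < j then Y $$ (i,l) else 0) else 0)"
    by (intro sum.cong) auto
  finally show ?thesis using ij by auto
qed

lemma shift_mat_pow:
  "shift_mat n ^\<^sub>m k = mat n n (\<lambda>(i,j). if j = i + k then 1 else (0::'a::ring_1))"
proof (induction k)
  case 0
  show ?case by (rule eq_matI) (auto simp: shift_mat_def)
next
  case (Suc k)
  show ?case
  proof (rule eq_matI)
    fix i j
    assume "i < dim_row (mat n n (\<lambda>(i,j). if j = i + Suc k then 1 else (0::'a)))"
      and "j < dim_col (mat n n (\<lambda>(i,j). if j = i + Suc k then 1 else (0::'a)))"
    then have "i < n" "j < n" by auto
    then show "(shift_mat n ^\<^sub>m Suc k) $$ (i,j) = mat n n (\<lambda>(i,j). if j = i + Suc k then 1 else (0::'a)) $$ (i,j)"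
      unfolding pow_mat.simps Suc by (subst mult_shift_mat) auto
  qed (auto simp: shift_mat_def)
qed

lemma shift_mat_nilpotent: "shift_mat n ^\<^sub>m n = (0\<^sub>m n n :: 'a::ring_1 mat)"
  unfolding shift_mat_pow by (rule eq_matI) auto

text \<open>With \<open>N\<close> the shift, \<open>T = N * Y - Y * N\<close> is a recursion along
  the diagonals: row \<open>i + 1\<close> of \<open>Y\<close> is row \<open>i\<close> moved one
  column to the right plus row \<open>i\<close> of \<open>T\<close>. The recursion can always be
  run; the only condition is that row \<open>n\<close>, which lies outside \<open>Y\<close>, comes
  out zero.\<close>

lemma upper_triangular_trace_zero:
  fixes T :: "'a::ring_1 mat"
  assumes T: "T \<in> carrier_mat n n" and ut: "upper_triangular T"
    and tr: "(\<Sum>i<n. T $$ (i,i)) = 0"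
  shows "T \<in> nil_commutators n"
proof -
  \<comment> \<open>The sum of the entries of \<open>T\<close> at \<open>(i - 1, j)\<close> and
    diagonally above it. The bound on \<open>k\<close> keeps the subtractions of \<open>k\<close>
    exact.\<close>
  define y where "y i j = (\<Sum>k<min i (Suc j). T $$ (i - 1 - k, j - k))" for i j
  define Y where "Y = mat n n (\<lambda>(i,j). y i j)"
  have Y: "Y \<in> carrier_mat n n" unfolding Y_def by simp
  have rec: "y (Suc i) j = T $$ (i,j) + (if 0 < j then y i (j - 1) else 0)" for i j
    unfolding y_def by (cases j) (simp_all add: sum.lessThan_Suc_shift del: sum.lessThan_Suc)
  \<comment> \<open>For \<open>j = n - 1\<close> the sum is the trace; for smaller \<open>j\<close>
    all its terms lie below the diagonal.\<close>
  have last: "y n j = 0" if "j < n" for j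
  proof (cases "Suc j = n")
    case True
    have "y n j = (\<Sum>k<n. T $$ (n - Suc k, n - Suc k))"
      unfolding y_def using True by (auto intro!: sum.cong)
    also have "\<dots> = 0" using tr by (simp add: sum.nat_diff_reindex[of "\<lambda>i. T $$ (i,i)"])
    finally show ?thesis .
  next
    case False
    show ?thesis unfolding y_def
      using False that T ut by (intro sum.neutral) (auto intro!: upper_triangularD)
  qed
  have "T = shift_mat n * Y - Y * shift_mat n"
  proof (rule eq_matI)
    fix i j assume "i < dim_row (shift_mat n * Y - Y * shift_mat n)" "j < dim_col (shift_mat n * Y - Y * shift_mat n)"
    then have ij: "i < n" "j < n" using Y by (auto simp: shift_mat_def)
    have "(shift_mat n * Y) $$ (i,j) = y (Suc i) j"
    proof (cases "Suc i < n")
      case True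
      then show ?thesis using ij Y by (simp add: shift_mat_mult Y_def del: index_mult_mat(1))
    next
      case False
      then have "Suc i = n" using ij by simp
      then show ?thesis using ij Y last by (simp add: shift_mat_mult del: index_mult_mat(1))
    qed
    moreover have "(Y * shift_mat n) $$ (i,j) = (if 0 < j then y i (j - 1) else 0)"
      using ij by (simp add: mult_shift_mat Y Y_def del: index_mult_mat(1))
    moreover have "(shift_mat n * Y - Y * shift_mat n) $$ (i,j) = (shift_mat n * Y) $$ (i,j) - (Y * shift_mat n) $$ (i,j)"
      using ij Y by (intro index_minus_mat) (auto simp: shift_mat_def)
    ultimately show "T $$ (i,j) = (shift_mat n * Y - Y * shift_mat n) $$ (i,j)"
      using rec[of i j] by simp
  qed (use T Y in \<open>auto simp: shift_mat_def\<close>)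
  then show ?thesis
    unfolding nil_commutators_def using Y shift_mat_nilpotent shift_mat_carrier by blast
qed

text \<open>Reversing the order of the basis is a similarity that makes \<open>T\<close> upper
  triangular and only permutes its diagonal entries.\<close>

lemma lower_triangular_trace_zero:
  fixes T :: "'a::ring_1 mat"
  assumes T: "T \<in> carrier_mat n n" and lt: "upper_triangular (transpose_mat T)"
    and tr: "(\<Sum>i<n. T $$ (i,i)) = 0"
  shows "T \<in> nil_commutators n"
proof -
  define f where "f i = (if i < n then n - Suc i else i)" for i
  have f: "f permutes {..<n}"
    by (rule bij_imp_permutes[OF bij_betw_byWitness[where f' = f]]) (auto simp: f_def)
  let ?S = "mat n n (\<lambda>(i,j). T $$ (f i, f j))"
  have "(\<Sum>i<n. ?S $$ (i,i)) = (\<Sum>i<n. T $$ (n - Suc i, n - Suc i))"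
    by (intro sum.cong) (auto simp: f_def)
  also have "\<dots> = 0" using tr by (simp add: sum.nat_diff_reindex[of "\<lambda>i. T $$ (i,i)"])
  finally have "(\<Sum>i<n. ?S $$ (i,i)) = 0" .
  moreover have "upper_triangular ?S"
  proof (rule upper_triangularI)
    fix i j assume ij: "j < i" "i < dim_row ?S"
    then have "transpose_mat T $$ (f j, f i) = 0"
      using T by (intro upper_triangularD[OF lt]) (auto simp: f_def)
    then show "?S $$ (i,j) = 0" using ij T by (auto simp: f_def)
  qed
  ultimately have "?S \<in> nil_commutators n" by (intro upper_triangular_trace_zero) auto
  then show ?thesis using similar_mat_permute[OF T f] nil_commutators_similar by blast
qed

section \<open>Adding a one-by-one corner to a commutator\<close>

text \<open>Blocks have to be matrices, so corner entries and pivots are wrapped as one-by-one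
  matrices.\<close>

definition scal :: "'a \<Rightarrow> 'a mat" where
  "scal d = mat 1 1 (\<lambda>_. d)"

lemma scal_carrier[simp]: "scal d \<in> carrier_mat 1 1" "scal d \<in> carrier_mat (Suc 0) (Suc 0)"
    "dim_row (scal d) = 1" "dim_col (scal d) = 1"
  and scal_index[simp]: "scal d $$ (0,0) = d"
  unfolding scal_def by auto

lemma scal_conv: "c \<in> carrier_mat 1 1 \<Longrightarrow> c = scal (c $$ (0,0))"
  unfolding scal_def by (intro eq_matI) auto

lemma transpose_scal[simp]: "transpose_mat (scal d) = scal d"
  unfolding scal_def by (rule eq_matI) auto

lemma upper_triangular_scal[simp]: "upper_triangular (scal d)"
  by (auto intro!: upper_triangularI)

lemma scal_mult: "scal (a::'a::ring_1) * scal b = scal (a * b)"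
  unfolding scal_def by (rule eq_matI) (auto simp: scalar_prod_def)

lemma scal_minus: "scal (a::'a::ring_1) - scal b = scal (a - b)"
  unfolding scal_def by (rule eq_matI) auto

lemma scal_one: "scal (1::'a::ring_1) = 1\<^sub>m 1"
  unfolding scal_def by (rule eq_matI) auto

text \<open>A commutator with left factor 0 is 0, which is also \<open>1 * 1 - 1 * 1\<close>. The
  nonzero left factor supplies the unit in Sylvester's equation.\<close>

lemma commutators_nonzero_witness:
  fixes c :: "'a::division_ring"
  assumes "c \<in> commutators UNIV"
  obtains a b where "a \<noteq> 0" "c = a * b - b * a"
proof -
  from assms obtain a b where ab: "c = a * b - b * a" unfolding commutators_def by blast
  show ?thesis
  proof (cases "a = 0")
    case True
    then show ?thesis using ab by (intro that[of 1 1]) auto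
  qed (use ab that in blast)
qed

lemma minus_four_block_mat:
  assumes "A1 \<in> carrier_mat n n'" "B1 \<in> carrier_mat n m'" "C1 \<in> carrier_mat m n'" "D1 \<in> carrier_mat m m'"
    and "A2 \<in> carrier_mat n n'" "B2 \<in> carrier_mat n m'" "C2 \<in> carrier_mat m n'" "D2 \<in> carrier_mat m m'"
  shows "four_block_mat A1 B1 C1 D1 - four_block_mat A2 B2 C2 D2
    = four_block_mat (A1 - A2) (B1 - B2) (C1 - C2) (D1 - D2)"
  using assms by (intro eq_matI) auto

text \<open>Commuting the block diagonal matrix of \<open>M\<close> and \<open>a\<close> with a
  matrix that has diagonal blocks \<open>Y\<close>, \<open>b\<close> and upper corner
  \<open>z\<close> gives diagonal blocks \<open>T\<close>, \<open>c\<close> for every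
  \<open>z\<close>, and upper corner \<open>M * z - z * scal a\<close>. As \<open>M\<close> is
  nilpotent and \<open>a\<close> is a unit, \<open>z\<close> can be chosen to make this corner
  \<open>w\<close>.\<close>

lemma upper_block_commutator:
  fixes T :: "'a::division_ring mat"
  assumes T: "T \<in> nil_commutators n" and c: "c \<in> commutators UNIV" and w: "w \<in> carrier_mat n 1"
  shows "four_block_mat T w (0\<^sub>m 1 n) (scal c) \<in> commutators (carrier_mat (Suc n) (Suc n))"
proof -
  obtain M Y k where M: "M \<in> carrier_mat n n" "Y \<in> carrier_mat n n" "M ^\<^sub>m k = 0\<^sub>m n n" "T = M * Y - Y * M"
    using T unfolding nil_commutators_def by blast
  obtain a b where ab: "a \<noteq> 0" "c = a * b - b * a" using commutators_nonzero_witness[OF c] .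
  \<comment> \<open>The sign is reversed because Sylvester's equation is solved in the form
    \<open>z * scal a - M * z\<close>.\<close>
  have "M ^\<^sub>m k * (- w) = 0\<^sub>m n 1"
    unfolding M(3) using w by (intro left_mult_zero_mat) auto
  then obtain z where z: "z \<in> carrier_mat n 1" "z * scal a - M * z = - w"
    using sylvester_nilpotent_col[of M n "scal a" 1 "scal (inverse a)" "- w" k] M(1,3) w ab(1)
    by (auto simp: scal_mult scal_one simp del: One_nat_def)
  let ?M = "four_block_mat M (0\<^sub>m n 1) (0\<^sub>m 1 n) (scal a)"
  let ?Y = "four_block_mat Y z (0\<^sub>m 1 n) (scal b)"
  have zero_diff: "0\<^sub>m (Suc 0) n - 0\<^sub>m (Suc 0) n = (0\<^sub>m (Suc 0) n :: 'a mat)" by (intro eq_matI) auto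
  have "M * z - z * scal a = - (z * scal a - M * z)" using M z(1) by (intro eq_matI) auto
  also have "\<dots> = w" using z(2) w by simp
  finally have w': "M * z - z * scal a = w" .
  have "?M * ?Y = four_block_mat (M * Y) (M * z) (0\<^sub>m 1 n) (scal (a * b))"
    using M z(1) by (subst mult_four_block_mat[of _ n n _ 1 _ 1 _ _ n _ 1]) (auto simp: scal_mult)
  moreover have "?Y * ?M = four_block_mat (Y * M) (z * scal a) (0\<^sub>m 1 n) (scal (b * a))"
    using M z(1) by (subst mult_four_block_mat[of _ n n _ 1 _ 1 _ _ n _ 1]) (auto simp: scal_mult)
  ultimately have "?M * ?Y - ?Y * ?M = four_block_mat T w (0\<^sub>m 1 n) (scal c)"
    using M z(1) by (simp add: minus_four_block_mat[of _ n n _ 1 _ 1] scal_minus w' ab zero_diff)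
  moreover have "?M \<in> carrier_mat (Suc n) (Suc n)" "?Y \<in> carrier_mat (Suc n) (Suc n)" using M by auto
  ultimately show ?thesis using commutatorsI by metis
qed

text \<open>Here \<open>z\<close> stands in the lower corner, and the commutator has there
  \<open>scal a * z - z * M\<close>; the row form of Sylvester's equation applies without a change
  of sign.\<close>

lemma lower_block_commutator:
  fixes T :: "'a::division_ring mat"
  assumes T: "T \<in> nil_commutators n" and c: "c \<in> commutators UNIV" and w: "w \<in> carrier_mat 1 n"
  shows "four_block_mat T (0\<^sub>m n 1) w (scal c) \<in> commutators (carrier_mat (Suc n) (Suc n))"
proof -
  obtain M Y k where M: "M \<in> carrier_mat n n" "Y \<in> carrier_mat n n" "M ^\<^sub>m k = 0\<^sub>m n n" "T = M * Y - Y * M"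
    using T unfolding nil_commutators_def by blast
  obtain a b where ab: "a \<noteq> 0" "c = a * b - b * a" using commutators_nonzero_witness[OF c] .
  obtain z where z: "z \<in> carrier_mat 1 n" "scal a * z - z * M = w"
    using sylvester_nilpotent_row[of M n "scal a" 1 "scal (inverse a)" w k] M(1,3) w ab(1)
    by (auto simp: scal_mult scal_one simp del: One_nat_def)
  let ?M = "four_block_mat M (0\<^sub>m n 1) (0\<^sub>m 1 n) (scal a)"
  let ?Y = "four_block_mat Y (0\<^sub>m n 1) z (scal b)"
  have zero_diff: "0\<^sub>m n (Suc 0) - 0\<^sub>m n (Suc 0) = (0\<^sub>m n (Suc 0) :: 'a mat)" by (intro eq_matI) auto
  have zM: "scal a * z \<in> carrier_mat 1 n" "z * M \<in> carrier_mat 1 n"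
    using mult_carrier_mat[OF scal_carrier(1) z(1)] mult_carrier_mat[OF z(1) M(1)] by auto
  have "?M * ?Y = four_block_mat (M * Y) (0\<^sub>m n 1) (scal a * z) (scal (a * b))"
    using M z(1) by (subst mult_four_block_mat[of _ n n _ 1 _ 1 _ _ n _ 1]) (auto simp: scal_mult)
  moreover have "?Y * ?M = four_block_mat (Y * M) (0\<^sub>m n 1) (z * M) (scal (b * a))"
    using M z(1) by (subst mult_four_block_mat[of _ n n _ 1 _ 1 _ _ n _ 1]) (auto simp: scal_mult)
  ultimately have "?M * ?Y - ?Y * ?M = four_block_mat T (0\<^sub>m n 1) w (scal c)"
    using M z zM by (simp add: minus_four_block_mat[of _ n n _ 1 _ 1] scal_minus ab zero_diff)
  moreover have "?M \<in> carrier_mat (Suc n) (Suc n)" "?Y \<in> carrier_mat (Suc n) (Suc n)" using M by auto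
  ultimately show ?thesis using commutatorsI by metis
qed

section \<open>Similar matrices with a prescribed pivot\<close>

text \<open>Conjugation by the unipotent matrix with upper corner \<open>p\<close>. It keeps
  \<open>C\<close> and changes the upper left block by \<open>p * C\<close>, which is how a pivot
  gets prescribed.\<close>

lemma four_block_conj_upper:
  fixes A :: "'a::ring_1 mat"
  assumes c: "A \<in> carrier_mat n n" "R \<in> carrier_mat n m" "C \<in> carrier_mat m n" "B \<in> carrier_mat m m"
    and p: "p \<in> carrier_mat n m"
  shows "similar_mat (four_block_mat A R C B)
    (four_block_mat (A + p * C) ((A + p * C) * (- p) + (R + p * B)) C (C * (- p) + B))"
proof -
  let ?P = "four_block_mat (1\<^sub>m n) p (0\<^sub>m m n) (1\<^sub>m m)"
  let ?Q = "four_block_mat (1\<^sub>m n) (- p) (0\<^sub>m m n) (1\<^sub>m m)"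
  let ?M = "four_block_mat A R C B"
  have z: "- 0\<^sub>m m m = (0\<^sub>m m m :: 'a mat)" by (intro eq_matI) auto
  have neg: "- p + p = 0\<^sub>m n m" "p + - p = 0\<^sub>m n m" using p by (auto intro!: eq_matI)
  have "?P * ?Q = four_block_mat (1\<^sub>m n) (- p + p) (0\<^sub>m m n) (1\<^sub>m m)"
    using p by (subst mult_four_block_mat[of _ n n _ m _ m _ _ n _ m]) (auto simp: z)
  moreover have "?Q * ?P = four_block_mat (1\<^sub>m n) (p + - p) (0\<^sub>m m n) (1\<^sub>m m)"
    using p by (subst mult_four_block_mat[of _ n n _ m _ m _ _ n _ m]) (auto simp: z)
  moreover have "?P * ?M = four_block_mat (A + p * C) (R + p * B) C B"
    using p c by (subst mult_four_block_mat[of _ n n _ m _ m _ _ n _ m]) (auto simp: z)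
  moreover have "four_block_mat (A + p * C) (R + p * B) C B * ?Q
      = four_block_mat (A + p * C) ((A + p * C) * (- p) + (R + p * B)) C (C * (- p) + B)"
    using p c by (subst mult_four_block_mat[of _ n n _ m _ m _ _ n _ m]) (auto simp: z)
  ultimately show ?thesis
    using p c neg z by (intro similar_mat_sym[OF similar_matI[of _ _ ?P ?Q "n + m"]]) auto
qed

text \<open>Conjugation by the unipotent matrix with lower corner \<open>v\<close>. When
  \<open>R\<close> and \<open>C\<close> vanish, the new lower corner is
  \<open>v * A - B * v\<close>, a source of nonzero off-diagonal entries.\<close>

lemma four_block_conj_lower:
  fixes A :: "'a::ring_1 mat"
  assumes c: "A \<in> carrier_mat n n" "R \<in> carrier_mat n m" "C \<in> carrier_mat m n" "B \<in> carrier_mat m m"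
    and v: "v \<in> carrier_mat m n"
  shows "similar_mat (four_block_mat A R C B)
    (four_block_mat (A + R * (- v)) R ((v * A + C) + (v * R + B) * (- v)) (v * R + B))"
proof -
  let ?P = "four_block_mat (1\<^sub>m n) (0\<^sub>m n m) v (1\<^sub>m m)"
  let ?Q = "four_block_mat (1\<^sub>m n) (0\<^sub>m n m) (- v) (1\<^sub>m m)"
  let ?M = "four_block_mat A R C B"
  have z: "- 0\<^sub>m m m = (0\<^sub>m m m :: 'a mat)" "- 0\<^sub>m n n = (0\<^sub>m n n :: 'a mat)" by (auto intro!: eq_matI)
  have neg: "- v + v = 0\<^sub>m m n" "v + - v = 0\<^sub>m m n" using v by (auto intro!: eq_matI)
  have "?P * ?Q = four_block_mat (1\<^sub>m n) (0\<^sub>m n m) (v + - v) (1\<^sub>m m)"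
    using v by (subst mult_four_block_mat[of _ n n _ m _ m _ _ n _ m]) (auto simp: z)
  moreover have "?Q * ?P = four_block_mat (1\<^sub>m n) (0\<^sub>m n m) (- v + v) (1\<^sub>m m)"
    using v by (subst mult_four_block_mat[of _ n n _ m _ m _ _ n _ m]) (auto simp: z)
  moreover have "?P * ?M = four_block_mat A R (v * A + C) (v * R + B)"
    using v c by (subst mult_four_block_mat[of _ n n _ m _ m _ _ n _ m]) (auto simp: z)
  moreover have "four_block_mat A R (v * A + C) (v * R + B) * ?Q
      = four_block_mat (A + R * (- v)) R ((v * A + C) + (v * R + B) * (- v)) (v * R + B)"
    using v c by (subst mult_four_block_mat[of _ n n _ m _ m _ _ n _ m]) (auto simp: z)
  ultimately show ?thesis
    using v c neg z by (intro similar_mat_sym[OF similar_matI[of _ _ ?P ?Q "n + m"]]) auto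
qed

lemma permutes_two_images:
  assumes "i < n" "j < n" "i \<noteq> j" "2 \<le> n"
  obtains f where "f permutes {..<n::nat}" "f 0 = j" "f 1 = i"
proof -
  let ?t = "transpose 0 j"
  have ti: "?t i \<noteq> 0" "?t i < n" using assms by (auto simp: transpose_def)
  \<comment> \<open>The right-hand swap takes 1 to \<open>?t i\<close> and fixes 0, because
    \<open>?t i\<close> is nonzero; then the involution \<open>?t\<close> takes \<open>?t i\<close>
    back to \<open>i\<close> and 0 to \<open>j\<close>.\<close>
  have "?t \<circ> transpose 1 (?t i) permutes {..<n}"
    using assms ti by (intro permutes_compose permutes_swap_id) auto
  moreover have "(?t \<circ> transpose 1 (?t i)) 0 = j" using ti by (simp add: transpose_def)
  moreover have "(?t \<circ> transpose 1 (?t i)) 1 = i" by simp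
  ultimately show ?thesis by (rule that)
qed

lemma split_first:
  fixes A :: "'a::ring_1 mat"
  assumes A: "A \<in> carrier_mat (Suc m) (Suc m)"
  obtains r c B where "r \<in> carrier_mat 1 m" "c \<in> carrier_mat m 1" "B \<in> carrier_mat m m"
    "A = four_block_mat (scal (A $$ (0,0))) r c B"
proof -
  obtain a r c B where s: "split_block A 1 1 = (a, r, c, B)" by (metis prod_cases4)
  note S = split_block[OF s, of m m]
  have "a = scal (A $$ (0,0))"
    using s unfolding split_block_def Let_def scal_def by (auto intro!: eq_matI)
  then show ?thesis using S A that[of r c B] by auto
qed

lemma nonscalar_similar_nonzero_entry:
  fixes A :: "'a::ring_1 mat"
  assumes A: "A \<in> carrier_mat n n" and n: "2 \<le> n"
    and ns: "\<forall>z \<in> ring_center. A \<noteq> z \<cdot>\<^sub>m 1\<^sub>m n"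
  shows "\<exists>A'. similar_mat A A' \<and> A' $$ (1,0) \<noteq> 0"
proof (cases "\<exists>i<n. \<exists>j<n. i \<noteq> j \<and> A $$ (i,j) \<noteq> 0")
  case True
  then obtain i j where ij: "i < n" "j < n" "i \<noteq> j" "A $$ (i,j) \<noteq> 0" by blast
  obtain f where f: "f permutes {..<n}" "f 0 = j" "f 1 = i" using permutes_two_images[OF ij(1-3) n] .
  show ?thesis
    using similar_mat_permute[OF A f(1)] ij f n by (intro exI[of _ "mat n n (\<lambda>(i,j). A $$ (f i, f j))"]) auto
next
  case False
  have "\<exists>i<n. \<exists>j<n. i \<noteq> j \<and> (\<exists>x. x * A $$ (j,j) \<noteq> A $$ (i,i) * x)"
  proof (rule ccontr)
    assume "\<not> ?thesis"
    then have comm: "x * A $$ (j,j) = A $$ (i,i) * x" if "i < n" "j < n" "i \<noteq> j" for i j x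
      using that by blast
    \<comment> \<open>Taking \<open>x = 1\<close> makes all diagonal entries equal; arbitrary
      \<open>x\<close> then makes their common value central.\<close>
    have eq: "A $$ (j,j) = A $$ (i,i)" if "i < n" "j < n" for i j
      using comm[of i j 1] that by (cases "i = j") auto
    have "A $$ (0,0) \<in> ring_center"
      unfolding ring_center_def using comm[of 0 1] eq[of 0 1] n by auto
    moreover have "A = A $$ (0,0) \<cdot>\<^sub>m 1\<^sub>m n"
    proof (rule eq_matI)
      fix i j assume "i < dim_row (A $$ (0,0) \<cdot>\<^sub>m 1\<^sub>m n)" "j < dim_col (A $$ (0,0) \<cdot>\<^sub>m 1\<^sub>m n)"
      then have ij: "i < n" "j < n" by auto
      then show "A $$ (i,j) = (A $$ (0,0) \<cdot>\<^sub>m 1\<^sub>m n) $$ (i,j)"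
        using False eq[of 0 i] n by (cases "i = j") auto
    qed (use A in auto)
    ultimately show False using ns by blast
  qed
  then obtain i j x where ij: "i < n" "j < n" "i \<noteq> j" "x * A $$ (j,j) \<noteq> A $$ (i,i) * x" by blast
  obtain f where f: "f permutes {..<n}" "f 0 = j" "f 1 = i" using permutes_two_images[OF ij(1-3) n] .
  obtain m where m: "n = Suc (Suc m)" using n by (metis Suc_le_D numeral_2_eq_2 Suc_le_mono)
  define A' where "A' = mat n n (\<lambda>(i,j). A $$ (f i, f j))"
  have A': "A' \<in> carrier_mat (Suc (Suc m)) (Suc (Suc m))" unfolding A'_def m by simp
  have off: "A' $$ (k,l) = 0" if "k < n" "l < n" "k \<noteq> l" for k l
    using that False permutes_in_image[OF f(1)] permutes_inj[OF f(1)]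
    unfolding A'_def by (auto dest: injD)
  obtain r c B where S: "r \<in> carrier_mat 1 (Suc m)" "c \<in> carrier_mat (Suc m) 1" "B \<in> carrier_mat (Suc m) (Suc m)"
    "A' = four_block_mat (scal (A' $$ (0,0))) r c B" using split_first[OF A'] .
  have r0: "r = 0\<^sub>m 1 (Suc m)"
  proof (rule eq_matI)
    fix k l assume "k < dim_row (0\<^sub>m 1 (Suc m) :: 'a mat)" "l < dim_col (0\<^sub>m 1 (Suc m) :: 'a mat)"
    then have kl: "k = 0" "l < Suc m" by auto
    have "A' $$ (0, Suc l) = r $$ (0,l)" by (subst S(4)) (use S(1-3) kl in auto)
    then show "r $$ (k,l) = 0\<^sub>m 1 (Suc m) $$ (k,l)" using off[of 0 "Suc l"] kl m by auto
  qed (use S in auto)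
  \<comment> \<open>Conjugation with this column adds \<open>x\<close> times row 0 to row 1, and
    correspondingly subtracts column 1 times \<open>x\<close> from column 0.\<close>
  define v where "v = mat (Suc m) 1 (\<lambda>(k,l). if k = 0 then x else 0)"
  have v: "v \<in> carrier_mat (Suc m) 1" unfolding v_def by simp
  let ?a = "scal (A' $$ (0,0))"
  let ?A = "four_block_mat (?a + r * (- v)) r ((v * ?a + c) + (v * r + B) * (- v)) (v * r + B)"
  have "similar_mat A' ?A"
    using four_block_conj_lower[of ?a 1 r "Suc m" c B v] S v by simp
  moreover have "similar_mat A A'"
    unfolding A'_def by (rule similar_mat_permute[OF A f(1)])
  ultimately have sim: "similar_mat A ?A" using similar_mat_trans by blast
  have "v * r + B = B" using S(1-3) v unfolding r0 by simp
  moreover have "(B * (- v)) $$ (0,0) = - (B $$ (0,0) * x)"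
  proof -
    have "(B * (- v)) $$ (0,0) = - (\<Sum>k\<in>{0..<Suc m}. B $$ (0,k) * (if k = 0 then x else 0))"
      using S(3) by (simp add: scalar_prod_def v_def sum_negf del: sum.op_ivl_Suc)
    also have "(\<Sum>k\<in>{0..<Suc m}. B $$ (0,k) * (if k = 0 then x else 0))
        = (\<Sum>k\<in>{0..<Suc m}. if k = 0 then B $$ (0,k) * x else 0)"
      by (intro sum.cong) auto
    also have "\<dots> = B $$ (0,0) * x" by (simp del: sum.op_ivl_Suc)
    finally show ?thesis .
  qed
  moreover have "(v * ?a) $$ (0,0) = x * A' $$ (0,0)"
    unfolding v_def scal_def by (simp add: scalar_prod_def)
  moreover have "c $$ (0,0) = A' $$ (1,0)" by (subst S(4)) (use S(1-3) in auto)
  moreover have "A' $$ (1,0) = 0" using off m by simp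
  moreover have "B $$ (0,0) = A' $$ (1,1)" by (subst S(4)) (use S(1-3) in auto)
  ultimately have "?A $$ (1,0) = x * A' $$ (0,0) - A' $$ (1,1) * x"
    using S(1-3) v by simp
  then have "?A $$ (1,0) \<noteq> 0" using ij f m by (simp add: A'_def)
  with sim show ?thesis by blast
qed

lemma col_mult_row:
  fixes c :: "'a::ring_1 mat"
  assumes "c \<in> carrier_mat m 1" "r \<in> carrier_mat 1 k" "i < m" "j < k"
  shows "(c * r) $$ (i,j) = c $$ (i,0) * r $$ (0,j)"
  using assms by (simp add: scalar_prod_def)

lemma col_scal_row:
  fixes c :: "'a::ring_1 mat"
  assumes "c \<in> carrier_mat m 1" "r \<in> carrier_mat 1 k" "i < m" "j < k"
  shows "(c * scal e * r) $$ (i,j) = c $$ (i,0) * e * r $$ (0,j)"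
  using assms by (simp add: col_mult_row[of _ m _ k] col_mult_row[of _ m _ 1] del: index_mult_mat(1))

text \<open>The corner changes by \<open>p * c\<close>, and since the first entry \<open>g\<close>
  of \<open>c\<close> is invertible, a row \<open>p\<close> supported there turns the corner into
  any \<open>d\<close>, zero included. The column \<open>c\<close> survives the conjugation.\<close>

lemma similar_mat_corner:
  fixes A :: "'a::division_ring mat"
  assumes A: "A \<in> carrier_mat (Suc m) (Suc m)" and m: "1 \<le> m"
    and ns: "\<forall>z \<in> ring_center. A \<noteq> z \<cdot>\<^sub>m 1\<^sub>m (Suc m)"
  shows "\<exists>r c B. r \<in> carrier_mat 1 m \<and> c \<in> carrier_mat m 1 \<and> B \<in> carrier_mat m m
    \<and> c $$ (0,0) \<noteq> 0 \<and> similar_mat A (four_block_mat (scal d) r c B)"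
proof -
  obtain A' where A': "similar_mat A A'" "A' $$ (1,0) \<noteq> 0"
    using nonscalar_similar_nonzero_entry[OF A _ ns] m by auto
  have "A' \<in> carrier_mat (Suc m) (Suc m)" using similar_mat_carrier[OF similar_mat_sym[OF A'(1)] A] .
  from split_first[OF this] obtain r c B where S: "r \<in> carrier_mat 1 m" "c \<in> carrier_mat m 1" "B \<in> carrier_mat m m"
    "A' = four_block_mat (scal (A' $$ (0,0))) r c B" .
  define a where "a = A' $$ (0,0)"
  define g where "g = c $$ (0,0)"
  have "A' $$ (1,0) = g" unfolding g_def by (subst S(4)) (use S(1-3) m in auto)
  then have g: "g \<noteq> 0" using A' by simp
  define p where "p = mat 1 m (\<lambda>(i,j). if j = 0 then (d - a) * inverse g else 0)"
  have p: "p \<in> carrier_mat 1 m" unfolding p_def by simp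
  have "(p * c) $$ (0,0) = (\<Sum>k\<in>{0..<m}. (if k = 0 then (d - a) * inverse g else 0) * c $$ (k,0))"
    using S(2) by (simp add: scalar_prod_def p_def)
  also have "\<dots> = (\<Sum>k\<in>{0..<m}. if k = 0 then (d - a) * inverse g * c $$ (k,0) else 0)"
    by (intro sum.cong) auto
  also have "\<dots> = d - a" using m g by (simp add: mult.assoc g_def)
  finally have pc: "scal a + p * c = scal d"
    using p S(2) by (intro eq_matI) auto
  define r1 where "r1 = scal d * (- p) + (r + p * B)"
  define B1 where "B1 = c * (- p) + B"
  have c1: "r1 \<in> carrier_mat 1 m" "B1 \<in> carrier_mat m m" unfolding r1_def B1_def using S p by auto
  have "similar_mat A' (four_block_mat (scal d) r1 c B1)"
    using four_block_conj_upper[of "scal a" 1 r m c B p] S p by (simp add: pc r1_def B1_def a_def[symmetric])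
  then have sim1: "similar_mat A (four_block_mat (scal d) r1 c B1)"
    using A'(1) similar_mat_trans by blast
  then show ?thesis using c1 S(2) g unfolding g_def by blast
qed

text \<open>Conjugating with a row that annihilates the column below the pivot changes the Schur complement
  by a nonzero square-zero matrix, so a nonzero central Schur complement can be avoided.\<close>

lemma similar_mat_pivot:
  fixes A :: "'a::division_ring mat"
  assumes A: "A \<in> carrier_mat (Suc m) (Suc m)" and m: "1 \<le> m"
    and ns: "\<forall>z \<in> ring_center. A \<noteq> z \<cdot>\<^sub>m 1\<^sub>m (Suc m)" and d: "d \<noteq> 0"
  shows "\<exists>r c S. r \<in> carrier_mat 1 m \<and> c \<in> carrier_mat m 1 \<and> S \<in> carrier_mat m m
    \<and> (m = 1 \<or> (\<forall>z \<in> ring_center. z \<noteq> 0 \<longrightarrow> S \<noteq> z \<cdot>\<^sub>m 1\<^sub>m m))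
    \<and> similar_mat A (four_block_mat (scal d) r c (S + c * scal (inverse d) * r))"
proof -
  obtain r1 c B1 where c: "c \<in> carrier_mat m 1" and c1: "r1 \<in> carrier_mat 1 m" "B1 \<in> carrier_mat m m"
    and g0: "c $$ (0,0) \<noteq> 0" and sim1: "similar_mat A (four_block_mat (scal d) r1 c B1)"
    using similar_mat_corner[OF A m ns] by blast
  define g where "g = c $$ (0,0)"
  have g: "g \<noteq> 0" using g0 by (simp add: g_def)
  \<comment> \<open>The Schur complement of the pivot \<open>d\<close>. It is kept unless it is a
    nonzero central scalar matrix of size at least two.\<close>
  define S1 where "S1 = B1 - c * scal (inverse d) * r1"
  have S1: "S1 \<in> carrier_mat m m" "B1 = S1 + c * scal (inverse d) * r1"
    unfolding S1_def using c1 c by (auto intro!: eq_matI simp: minus_carrier_mat)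
  show ?thesis
  proof (cases "m = 1 \<or> (\<forall>z \<in> ring_center. z \<noteq> 0 \<longrightarrow> S1 \<noteq> z \<cdot>\<^sub>m 1\<^sub>m m)")
    case True
    then show ?thesis
      using sim1[unfolded S1(2)] S1(1) c1(1) c by blast
  next
    case False
    then obtain z where z: "z \<noteq> 0" "S1 = z \<cdot>\<^sub>m 1\<^sub>m m" by blast
    have m2: "2 \<le> m" using False m by auto
    \<comment> \<open>The first entry is chosen to cancel the contribution of the second one in
      \<open>q * c\<close>, so the pivot stays \<open>d\<close>.\<close>
    define q where "q = mat 1 m (\<lambda>(i,j). if j = 0 then - c $$ (1,0) * inverse g else if j = 1 then 1 else 0)"
    have q: "q \<in> carrier_mat 1 m" unfolding q_def by simp
    have "(q * c) $$ (0,0) = (\<Sum>k\<in>{0..<m}. (if k = 0 then - c $$ (1,0) * inverse g else if k = 1 then 1 else 0) * c $$ (k,0))"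
      using c by (simp add: scalar_prod_def q_def)
    also have "\<dots> = (\<Sum>k\<in>{0..<m}. (if k = 0 then - c $$ (1,0) * inverse g * c $$ (k,0) else 0)
        + (if k = 1 then c $$ (k,0) else 0))"
      by (intro sum.cong) auto
    also have "\<dots> = 0" using m2 g by (simp add: sum.distrib mult.assoc g_def)
    finally have qc0: "q * c = 0\<^sub>m 1 1" using q c by (intro eq_matI) auto
    then have qc: "scal d + q * c = scal d" by simp
    define r2 where "r2 = scal d * (- q) + (r1 + q * B1)"
    define B2 where "B2 = c * (- q) + B1"
    have c2: "r2 \<in> carrier_mat 1 m" "B2 \<in> carrier_mat m m" unfolding r2_def B2_def using c c1 q by auto
    have "similar_mat (four_block_mat (scal d) r1 c B1) (four_block_mat (scal d) r2 c B2)"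
      using four_block_conj_upper[of "scal d" 1 r1 m c B1 q] c c1 q by (simp add: qc r2_def B2_def)
    then have sim2: "similar_mat A (four_block_mat (scal d) r2 c B2)"
      using sim1 similar_mat_trans by blast
    define S2 where "S2 = B2 - c * scal (inverse d) * r2"
    have S2: "S2 \<in> carrier_mat m m" "B2 = S2 + c * scal (inverse d) * r2"
      unfolding S2_def using c2 c by (auto intro!: eq_matI simp: minus_carrier_mat)
    \<comment> \<open>As \<open>q * c = 0\<close>, only the scalar part of \<open>B1\<close> is seen
      by \<open>q\<close>.\<close>
    have "q * (c * scal (inverse d) * r1) = q * c * scal (inverse d) * r1"
      using q c c1 by (simp add: assoc_mult_mat[of _ 1 m _ 1 _ m] assoc_mult_mat[of _ 1 m _ 1 _ 1] assoc_mult_mat[of _ m 1 _ 1 _ m] assoc_mult_mat[of _ 1 1 _ 1 _ m])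
    also have "\<dots> = 0\<^sub>m 1 m" using c1 by (simp add: qc0 left_mult_zero_mat[of _ 1])
    finally have q0: "q * (c * scal (inverse d) * r1) = 0\<^sub>m 1 m" .
    have "c * scal (inverse d) * r1 \<in> carrier_mat m m"
      by (rule mult_carrier_mat[OF mult_carrier_mat[OF c scal_carrier(1)] c1(1)])
    then have "q * B1 = q * (z \<cdot>\<^sub>m 1\<^sub>m m) + q * (c * scal (inverse d) * r1)"
      unfolding S1(2) z(2) by (intro mult_add_distrib_mat[OF q]) auto
    then have "q * B1 = q * (z \<cdot>\<^sub>m 1\<^sub>m m)" using q by (simp add: q0)
    moreover have "(q * (z \<cdot>\<^sub>m 1\<^sub>m m)) $$ (0,1) = (\<Sum>k\<in>{0..<m}. q $$ (0,k) * (z * (if k = 1 then 1 else 0)))"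
      using q m2 by (simp add: scalar_prod_def)
    then have "(q * (z \<cdot>\<^sub>m 1\<^sub>m m)) $$ (0,1) = (\<Sum>k\<in>{0..<m}. if k = 1 then q $$ (0,k) * z else 0)"
      by (simp add: if_distrib[of "\<lambda>x. _ * (_ * x)"] cong: if_cong)
    ultimately have qB: "(q * B1) $$ (0,1) = z" using m2 by (simp add: q_def)
    \<comment> \<open>One off-diagonal entry is enough: at \<open>(0,1)\<close> the old complement
      is 0, and the new one turns out to be \<open>- (g * inverse d * z)\<close>, a product of
      nonzero elements up to sign.\<close>
    have "r2 $$ (0,1) = (scal d * (- q)) $$ (0,1) + (r1 $$ (0,1) + (q * B1) $$ (0,1))"
      using m2 q c1 by (simp add: r2_def del: index_mult_mat(1))
    also have "(scal d * (- q)) $$ (0,1) = scal d $$ (0,0) * (- q) $$ (0,1)"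
      using m2 q by (intro col_mult_row[of _ 1 _ m]) auto
    also have "\<dots> = - d" using m2 by (simp add: q_def)
    finally have r2e: "r2 $$ (0,1) = - d + (r1 $$ (0,1) + z)" unfolding qB .
    have B1e: "B1 $$ (0,1) = g * inverse d * r1 $$ (0,1)"
      using m2 c1 c by (simp add: S1(2) z(2) col_scal_row[of _ m _ m] g_def del: index_mult_mat(1))
    have "B2 $$ (0,1) = - g + B1 $$ (0,1)"
      using m2 c1 c q by (simp add: B2_def col_mult_row[of _ m _ m] del: index_mult_mat(1)) (simp add: q_def g_def)
    moreover have "S2 $$ (0,1) = B2 $$ (0,1) - g * inverse d * r2 $$ (0,1)"
      using m2 c2 c by (simp add: S2_def col_scal_row[of _ m _ m] g_def[symmetric] del: index_mult_mat(1))
    ultimately have "S2 $$ (0,1) = - g + g * inverse d * r1 $$ (0,1) - g * inverse d * (- d + (r1 $$ (0,1) + z))"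
      unfolding r2e B1e by (simp only:)
    also have "\<dots> = - (g * inverse d * z)"
      using d by (simp add: algebra_simps)
    finally have "S2 $$ (0,1) \<noteq> 0" using g d z by simp
    then have ns2: "S2 \<noteq> y \<cdot>\<^sub>m 1\<^sub>m m" for y using m2 by auto
    then show ?thesis
      using sim2[unfolded S2(2)] S2(1) c2(1) c ns2 by blast
  qed
qed

section \<open>Triangular matrices as commutators\<close>

text \<open>For \<open>s = 0\<close> either alternative makes a triangular matrix a commutator. The first one is needed
  when a Schur complement of size at least two vanishes: then there is no pivot to prescribe.\<close>

definition split_trace :: "nat \<Rightarrow> 'a::ring_1 \<Rightarrow> 'a mat \<Rightarrow> bool" where
  "split_trace k s T \<longleftrightarrow> (\<Sum>i<Suc k. T $$ (i,i)) = s
     \<or> ((\<Sum>i<k. T $$ (i,i)) = s \<and> T $$ (k,k) \<in> commutators UNIV)"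

text \<open>The new corner is placed first, so the last diagonal entry stays last, and in either
  alternative the sum grows by \<open>d\<close>.\<close>

lemma split_trace_four_block:
  assumes T: "T \<in> carrier_mat (Suc k) (Suc k)" and s: "split_trace k s T"
  shows "split_trace (Suc k) (s + d) (four_block_mat (scal d) R C T)"
proof -
  let ?F = "four_block_mat (scal d) R C T"
  have F0: "?F $$ (0,0) = d" using T by simp
  have FS: "?F $$ (Suc i, Suc i) = T $$ (i,i)" if "i < Suc k" for i using T that by simp
  have sum: "(\<Sum>i<Suc m. ?F $$ (i,i)) = d + (\<Sum>i<m. T $$ (i,i))" if "m \<le> Suc k" for m
    unfolding sum.lessThan_Suc_shift F0 using that FS by (intro arg_cong2[of _ _ _ _ "(+)"] sum.cong) auto
  show ?thesis
    using s FS[of k] sum[of k] sum[of "Suc k"] unfolding split_trace_def by (auto simp: add.commute)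
qed

text \<open>Trace zero is settled by the shift. In the other alternative the leading block of size
  \<open>k\<close> has trace zero and the last entry is a commutator, so the block lemma
  applies.\<close>

lemma upper_triangular_commutator:
  fixes T :: "'a::division_ring mat"
  assumes T: "T \<in> carrier_mat (Suc k) (Suc k)" and ut: "upper_triangular T" and s: "split_trace k 0 T"
  shows "T \<in> commutators (carrier_mat (Suc k) (Suc k))"
proof (cases "(\<Sum>i<Suc k. T $$ (i,i)) = 0")
  case True
  then show ?thesis using upper_triangular_trace_zero[OF T ut] nil_commutators_subset by blast
next
  case False
  then have tr: "(\<Sum>i<k. T $$ (i,i)) = 0" and cm: "T $$ (k,k) \<in> commutators UNIV"
    using s unfolding split_trace_def by auto
  obtain A w v a where sb: "split_block T k k = (A, w, v, a)" by (metis prod_cases4)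
  note S = split_block[OF sb, of 1 1]
  have Ac: "A \<in> carrier_mat k k" "w \<in> carrier_mat k 1" "T = four_block_mat A w v a" using S T by auto
  have ai: "A $$ (i,j) = T $$ (i,j)" if "i < k" "j < k" for i j
    using sb that unfolding split_block_def Let_def by auto
  have "a = scal (T $$ (k,k))"
    using sb T unfolding split_block_def Let_def scal_def by (auto intro!: eq_matI)
  moreover have "v = 0\<^sub>m 1 k"
    using sb T upper_triangularD[OF ut] unfolding split_block_def Let_def by (auto intro!: eq_matI)
  moreover have "A \<in> nil_commutators k"
    using Ac(1) tr T ai upper_triangularD[OF ut]
    by (intro upper_triangular_trace_zero) (auto intro!: upper_triangularI)
  ultimately show ?thesis using upper_block_commutator[OF _ cm Ac(2)] Ac(3) by metis
qed

text \<open>The same two cases as for upper triangular matrices, now with the last row as the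
  possibly nonzero border.\<close>

lemma lower_triangular_commutator:
  fixes T :: "'a::division_ring mat"
  assumes T: "T \<in> carrier_mat (Suc k) (Suc k)" and lt: "upper_triangular (transpose_mat T)" and s: "split_trace k 0 T"
  shows "T \<in> commutators (carrier_mat (Suc k) (Suc k))"
proof (cases "(\<Sum>i<Suc k. T $$ (i,i)) = 0")
  case True
  then show ?thesis using lower_triangular_trace_zero[OF T lt] nil_commutators_subset by blast
next
  case False
  then have tr: "(\<Sum>i<k. T $$ (i,i)) = 0" and cm: "T $$ (k,k) \<in> commutators UNIV"
    using s unfolding split_trace_def by auto
  have low: "T $$ (j,i) = 0" if "j < i" "i < Suc k" for i j
    using upper_triangularD[OF lt that(1)] that T by simp
  obtain A w v a where sb: "split_block T k k = (A, w, v, a)" by (metis prod_cases4)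
  note S = split_block[OF sb, of 1 1]
  have Ac: "A \<in> carrier_mat k k" "v \<in> carrier_mat 1 k" "T = four_block_mat A w v a" using S T by auto
  have ai: "A $$ (i,j) = T $$ (i,j)" if "i < k" "j < k" for i j
    using sb that unfolding split_block_def Let_def by auto
  have "a = scal (T $$ (k,k))"
    using sb T unfolding split_block_def Let_def scal_def by (auto intro!: eq_matI)
  moreover have "w = 0\<^sub>m k 1"
    using sb T low unfolding split_block_def Let_def by (auto intro!: eq_matI)
  moreover have "A \<in> nil_commutators k"
    using Ac(1) tr ai low
    by (intro lower_triangular_trace_zero) (auto intro!: upper_triangularI)
  ultimately show ?thesis using lower_block_commutator[OF _ cm Ac(2)] Ac(3) by metis
qed

section \<open>Lower-upper factorization with prescribed pivots\<close>

text \<open>If \<open>S = P * T * Q\<close>, conjugation acting only on the lower block fixes the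
  pivot and takes \<open>r\<close>, \<open>c\<close> to \<open>r * P\<close>, \<open>Q * c\<close>.
  The rank-one term is transformed along with them, so the Schur complement can be replaced by any
  similar matrix.\<close>

lemma similar_schur_complement:
  fixes S :: "'a::ring_1 mat"
  assumes c: "r \<in> carrier_mat 1 m" "c \<in> carrier_mat m 1" "S \<in> carrier_mat m m" "e \<in> carrier_mat 1 1"
    and sim: "similar_mat S T"
  shows "\<exists>r' c'. r' \<in> carrier_mat 1 m \<and> c' \<in> carrier_mat m 1 \<and>
    similar_mat (four_block_mat (scal d) r c (S + c * e * r)) (four_block_mat (scal d) r' c' (T + c' * e * r'))"
proof -
  obtain P Q where w: "similar_mat_wit S T P Q" using sim unfolding similar_mat_def by blast
  note D = similar_mat_witD2[OF c(3) w]
  note assoc = assoc_mult_mat[of _ m m _ m _ m] assoc_mult_mat[of _ m m _ m _ 1] assoc_mult_mat[of _ 1 m _ m _ m]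
    assoc_mult_mat[of _ m m _ 1 _ 1] assoc_mult_mat[of _ m 1 _ 1 _ m] assoc_mult_mat[of _ 1 1 _ 1 _ m]
    assoc_mult_mat[of _ m m _ 1 _ m] assoc_mult_mat[of _ m 1 _ m _ m] assoc_mult_mat[of _ 1 1 _ m _ m] assoc_mult_mat[of _ 1 m _ m _ m]
  have r: "r * P * Q = r" using D c by (simp add: assoc del: One_nat_def)
  have c': "P * (Q * c) = c" using D c by (simp add: assoc_mult_mat[of _ m m _ m _ 1, symmetric] del: One_nat_def)
  have "P * (Q * c * e * (r * P)) * Q = P * (Q * c) * e * (r * P * Q)"
    using D c by (simp add: assoc del: One_nat_def)
  then have cer: "P * (Q * c * e * (r * P)) * Q = c * e * r" by (simp only: r c')
  have carr: "Q * c * e * (r * P) \<in> carrier_mat m m" "c * e * r \<in> carrier_mat m m"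
    using c D(6,7) by (meson mult_carrier_mat)+
  have "P * (T + Q * c * e * (r * P)) * Q = P * T * Q + P * (Q * c * e * (r * P)) * Q"
    using D carr by (simp add: mult_add_distrib_mat[of _ m m _ m] add_mult_distrib_mat[of _ m m _ _ m])
  also have "\<dots> = S + c * e * r" using D(3) cer by simp
  finally have "similar_mat_wit (S + c * e * r) (T + Q * c * e * (r * P)) P Q"
    using D c carr by (intro similar_mat_witI[where n = m]) auto
  moreover have "similar_mat_wit (scal d) (scal d) (1\<^sub>m 1) (1\<^sub>m 1)" by (rule similar_mat_wit_refl) simp
  moreover have "r = 1\<^sub>m 1 * (r * P) * Q" using r c D by simp
  moreover have "c = P * (Q * c) * 1\<^sub>m 1" using c' c D by simp
  moreover have "S + c * e * r \<in> carrier_mat m m" "Q * c \<in> carrier_mat m 1" "r * P \<in> carrier_mat 1 m"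
    using c D carr by auto
  ultimately show ?thesis
    unfolding similar_mat_def
    using similar_mat_wit_four_block[of "scal d" "scal d" "1\<^sub>m 1" "1\<^sub>m 1" "S + c * e * r" "T + Q * c * e * (r * P)" P Q r "r * P" c "Q * c" 1 m]
    by (metis scal_carrier(1))
qed

text \<open>Induction on the number of prescribed pivots. The pivot \<open>l k * l k\<close> is
  split off, the Schur complement is factored by induction, and each triangular factor receives one
  \<open>l k\<close>; prescribing squares gives both factors the same sum of diagonal entries. A
  complement that vanishes is allowed and treated separately.\<close>

lemma similar_lower_upper:
  fixes A :: "'a::division_ring mat" and l :: "nat \<Rightarrow> 'a"
  assumes prod: "\<And>d::'a. \<exists>x \<in> commutators UNIV. \<exists>y \<in> commutators UNIV. d = x * y"
    and l: "\<And>i. i < k \<Longrightarrow> l i \<noteq> 0"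
    and A: "A \<in> carrier_mat (Suc k) (Suc k)"
    and ns: "k = 0 \<or> (\<forall>z \<in> ring_center. z \<noteq> 0 \<longrightarrow> A \<noteq> z \<cdot>\<^sub>m 1\<^sub>m (Suc k))"
  shows "\<exists>L U. L \<in> carrier_mat (Suc k) (Suc k) \<and> U \<in> carrier_mat (Suc k) (Suc k) \<and> similar_mat A (L * U)
    \<and> upper_triangular (transpose_mat L) \<and> upper_triangular U
    \<and> split_trace k (\<Sum>i<k. l i) L \<and> split_trace k (\<Sum>i<k. l i) U"
  using l A ns
proof (induction k arbitrary: A)
  case 0
  \<comment> \<open>No pivot is left to prescribe: the single entry is a product of two commutators,
    which is the second alternative of \<open>split_trace\<close> with an empty sum.\<close>
  obtain x y where xy: "x \<in> commutators UNIV" "y \<in> commutators UNIV" "A $$ (0,0) = x * y"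
    using prod by blast
  have "A = scal x * scal y"
    unfolding scal_mult using 0 xy(3) by (intro eq_matI) (auto simp: scal_def)
  then have "similar_mat A (scal x * scal y)" using similar_mat_refl[OF 0(2)] by simp
  then show ?case
    using xy by (intro exI[of _ "scal x"] exI[of _ "scal y"])
      (auto simp: split_trace_def intro!: upper_triangularI)
next
  case (Suc k)
  show ?case
  proof (cases "A = 0\<^sub>m (Suc (Suc k)) (Suc (Suc k))")
    case True
    \<comment> \<open>The zero matrix is the product of two diagonal matrices whose only possibly
      nonzero entries sit at different places. Each has full trace \<open>s\<close>, the first
      alternative of \<open>split_trace\<close>.\<close>
    define s where "s = (\<Sum>i<Suc k. l i)"
    define L where "L = mat (Suc (Suc k)) (Suc (Suc k)) (\<lambda>(i,j). if i = 0 \<and> j = 0 then s else 0)"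
    define U where "U = mat (Suc (Suc k)) (Suc (Suc k)) (\<lambda>(i,j). if i = 1 \<and> j = 1 then s else 0)"
    have "L * U = A" unfolding True
    proof (rule eq_matI)
      fix i j assume "i < dim_row (0\<^sub>m (Suc (Suc k)) (Suc (Suc k)) :: 'a mat)" "j < dim_col (0\<^sub>m (Suc (Suc k)) (Suc (Suc k)) :: 'a mat)"
      then have "(L * U) $$ (i,j) = (\<Sum>m\<in>{0..<Suc (Suc k)}. L $$ (i,m) * U $$ (m,j))"
        by (simp add: L_def U_def scalar_prod_def del: sum.op_ivl_Suc)
      also have "\<dots> = 0" using \<open>i < _\<close> \<open>j < _\<close>
        by (intro sum.neutral) (auto simp: L_def U_def)
      finally show "(L * U) $$ (i,j) = 0\<^sub>m (Suc (Suc k)) (Suc (Suc k)) $$ (i,j)"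
        using \<open>i < _\<close> \<open>j < _\<close> by simp
    qed (auto simp: L_def U_def)
    then have "similar_mat A (L * U)" using similar_mat_refl[OF Suc.prems(2)] by simp
    moreover have "(\<Sum>i<Suc (Suc k). L $$ (i,i)) = (\<Sum>i<Suc (Suc k). if i = 0 then s else 0)"
      by (intro sum.cong) (auto simp: L_def)
    then have "split_trace (Suc k) s L" unfolding split_trace_def by (simp del: sum.lessThan_Suc)
    moreover have "(\<Sum>i<Suc (Suc k). U $$ (i,i)) = (\<Sum>i<Suc (Suc k). if i = 1 then s else 0)"
      by (intro sum.cong) (auto simp: U_def)
    then have "split_trace (Suc k) s U" unfolding split_trace_def by (simp del: sum.lessThan_Suc)
    ultimately show ?thesis
      by (intro exI[of _ L] exI[of _ U]) (auto simp: L_def U_def s_def intro!: upper_triangularI)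
  next
    case False
    have "\<forall>z \<in> ring_center. A \<noteq> z \<cdot>\<^sub>m 1\<^sub>m (Suc (Suc k))"
    proof
      fix z :: 'a assume "z \<in> ring_center"
      moreover have "0 \<cdot>\<^sub>m 1\<^sub>m (Suc (Suc k)) = (0\<^sub>m (Suc (Suc k)) (Suc (Suc k)) :: 'a mat)"
        by (intro eq_matI) auto
      ultimately show "A \<noteq> z \<cdot>\<^sub>m 1\<^sub>m (Suc (Suc k))" using False Suc.prems(3) by (cases "z = 0") auto
    qed
    moreover have lk: "l k \<noteq> 0" using Suc.prems(1) by simp
    ultimately obtain r c S where S: "r \<in> carrier_mat 1 (Suc k)" "c \<in> carrier_mat (Suc k) 1" "S \<in> carrier_mat (Suc k) (Suc k)"
      and nsS: "Suc k = 1 \<or> (\<forall>z \<in> ring_center. z \<noteq> 0 \<longrightarrow> S \<noteq> z \<cdot>\<^sub>m 1\<^sub>m (Suc k))"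
      and sim1: "similar_mat A (four_block_mat (scal (l k * l k)) r c (S + c * scal (inverse (l k * l k)) * r))"
      using similar_mat_pivot[OF Suc.prems(2), of "l k * l k"] by auto
    obtain L U where LU: "L \<in> carrier_mat (Suc k) (Suc k)" "U \<in> carrier_mat (Suc k) (Suc k)" "similar_mat S (L * U)"
      "upper_triangular (transpose_mat L)" "upper_triangular U"
      "split_trace k (\<Sum>i<k. l i) L" "split_trace k (\<Sum>i<k. l i) U"
      using Suc.IH[of S] Suc.prems(1) S(3) nsS by auto
    obtain r' c' where rc: "r' \<in> carrier_mat 1 (Suc k)" "c' \<in> carrier_mat (Suc k) 1"
      and sim2: "similar_mat (four_block_mat (scal (l k * l k)) r c (S + c * scal (inverse (l k * l k)) * r))
        (four_block_mat (scal (l k * l k)) r' c' (L * U + c' * scal (inverse (l k * l k)) * r'))"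
      using similar_schur_complement[OF S scal_carrier(1) LU(3)] by blast
    \<comment> \<open>The column is divided by \<open>l k\<close> from the right and the row from
      the left, so that the pivots of the two factors restore \<open>c'\<close> and
      \<open>r'\<close>.\<close>
    define ll ur where "ll = c' * scal (inverse (l k))" and "ur = scal (inverse (l k)) * r'"
    have lu: "ll \<in> carrier_mat (Suc k) 1" "ur \<in> carrier_mat 1 (Suc k)" unfolding ll_def ur_def
      using mult_carrier_mat[OF rc(2) scal_carrier(1)] mult_carrier_mat[OF scal_carrier(1) rc(1)] by auto
    let ?L = "four_block_mat (scal (l k)) (0\<^sub>m 1 (Suc k)) ll L"
    let ?U = "four_block_mat (scal (l k)) ur (0\<^sub>m (Suc k) 1) U"
    have e1: "scal (l k) * ur = r'"
      unfolding ur_def using rc lk by (simp add: assoc_mult_mat[of _ 1 1 _ 1 _ "Suc k", symmetric] scal_mult scal_one del: One_nat_def)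
    have e2: "ll * scal (l k) = c'"
      unfolding ll_def using rc lk by (simp add: assoc_mult_mat[of _ "Suc k" 1 _ 1 _ 1] scal_mult scal_one del: One_nat_def)
    \<comment> \<open>The two inverses meet in the middle, so \<open>ll * ur\<close> is exactly the
      rank-one term by which the lower block exceeds \<open>L * U\<close>.\<close>
    have "ll * ur = c' * (scal (inverse (l k)) * ur)"
      unfolding ll_def by (rule assoc_mult_mat[OF rc(2) scal_carrier(1) lu(2)])
    also have "scal (inverse (l k)) * ur = scal (inverse (l k * l k)) * r'"
      unfolding ur_def using rc lk
      by (simp add: assoc_mult_mat[of _ 1 1 _ 1 _ "Suc k", symmetric] scal_mult nonzero_inverse_mult_distrib del: One_nat_def)
    also have "c' * \<dots> = c' * scal (inverse (l k * l k)) * r'"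
      by (rule assoc_mult_mat[OF rc(2) scal_carrier(1) rc(1), symmetric])
    finally have e3: "ll * ur = c' * scal (inverse (l k * l k)) * r'" .
    have e3c: "ll * ur \<in> carrier_mat (Suc k) (Suc k)" by (rule mult_carrier_mat[OF lu])
    have "?L * ?U = four_block_mat (scal (l k) * scal (l k) + 0\<^sub>m 1 (Suc k) * 0\<^sub>m (Suc k) 1)
        (scal (l k) * ur + 0\<^sub>m 1 (Suc k) * U) (ll * scal (l k) + L * 0\<^sub>m (Suc k) 1) (ll * ur + L * U)"
      using lu LU by (intro mult_four_block_mat) auto
    also have "\<dots> = four_block_mat (scal (l k * l k)) r' c' (L * U + c' * scal (inverse (l k * l k)) * r')"
      unfolding e1 e2 scal_mult using e3c rc LU by (simp add: e3[symmetric] comm_add_mat[of _ "Suc k" "Suc k"])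
    finally have "similar_mat A (?L * ?U)"
      using similar_mat_trans[OF sim1 sim2] by simp
    moreover have "transpose_mat ?L = four_block_mat (scal (l k)) (transpose_mat ll) (0\<^sub>m (Suc k) 1) (transpose_mat L)"
      using transpose_four_block_mat[OF scal_carrier(1) zero_carrier_mat lu(1) LU(1), of "l k"] by simp
    then have "upper_triangular (transpose_mat ?L)"
      using upper_triangular_four_block[of "scal (l k)" 1 "transpose_mat L" "Suc k" "transpose_mat ll"] LU by auto
    moreover have "upper_triangular ?U"
      using upper_triangular_four_block[of "scal (l k)" 1 U "Suc k" ur] LU by auto
    moreover have "split_trace (Suc k) (\<Sum>i<Suc k. l i) ?L" "split_trace (Suc k) (\<Sum>i<Suc k. l i) ?U"
      using split_trace_four_block[OF LU(1,6), of "l k"] split_trace_four_block[OF LU(2,7), of "l k"] by auto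
    moreover have "?L \<in> carrier_mat (Suc (Suc k)) (Suc (Suc k))" "?U \<in> carrier_mat (Suc (Suc k)) (Suc (Suc k))"
      using LU by auto
    ultimately show ?thesis by blast
  qed
qed

section \<open>Choice of the pivots, small and scalar cases, conclusion\<close>

text \<open>The terms are chosen one at a time so that the remaining sum never becomes zero.\<close>

lemma nonzero_sequence_sum:
  fixes w s :: "'a::division_ring"
  assumes w: "w \<noteq> 0" "w \<noteq> 1" and s: "s \<noteq> 0"
  shows "\<exists>l. (\<forall>i<Suc k. l i \<noteq> 0) \<and> (\<Sum>i<Suc k. l i) = s"
  using s
proof (induction k arbitrary: s)
  case 0
  then show ?case by (intro exI[of _ "\<lambda>_. s"]) simp
next
  case (Suc k)
  \<comment> \<open>At least one of 1 and \<open>w\<close> differs from \<open>s\<close>.\<close>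
  obtain t :: 'a where t: "t \<noteq> 0" "t \<noteq> s" using w zero_neq_one by metis
  then obtain l where l: "\<forall>i<Suc k. l i \<noteq> 0" "(\<Sum>i<Suc k. l i) = s - t" using Suc.IH[of "s - t"] by auto
  have "(\<Sum>i<Suc k. (l(Suc k := t)) i) = s - t" unfolding l(2)[symmetric] by (intro sum.cong) auto
  then show ?case using l t by (intro exI[of _ "l(Suc k := t)"]) (auto simp: less_Suc_eq)
qed

lemma scalar_mat_mult:
  "(a \<cdot>\<^sub>m 1\<^sub>m n) * (b \<cdot>\<^sub>m 1\<^sub>m n) = ((a * b) \<cdot>\<^sub>m 1\<^sub>m n :: 'a::ring_1 mat)"
proof (rule eq_matI)
  fix i j assume "i < dim_row ((a * b) \<cdot>\<^sub>m 1\<^sub>m n)" "j < dim_col ((a * b) \<cdot>\<^sub>m 1\<^sub>m n)"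
  then have ij: "i < n" "j < n" by auto
  have "((a \<cdot>\<^sub>m 1\<^sub>m n) * (b \<cdot>\<^sub>m 1\<^sub>m n)) $$ (i,j)
      = (\<Sum>k\<in>{0..<n}. a * (if k = i then 1 else 0) * (b * (if k = j then 1 else 0)))"
    using ij by (simp add: scalar_prod_def)
  also have "\<dots> = (\<Sum>k\<in>{0..<n}. if k = i then a * b * (if i = j then 1 else 0) else 0)"
    by (intro sum.cong) auto
  finally show "((a \<cdot>\<^sub>m 1\<^sub>m n) * (b \<cdot>\<^sub>m 1\<^sub>m n)) $$ (i,j) = ((a * b) \<cdot>\<^sub>m 1\<^sub>m n) $$ (i,j)"
    using ij by simp
qed auto

lemma scalar_mat_commutator:
  assumes "c \<in> commutators (UNIV :: 'a::ring_1 set)"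
  shows "c \<cdot>\<^sub>m 1\<^sub>m n \<in> commutators (carrier_mat n n)"
proof -
  obtain a b where "c = a * b - b * a" using assms unfolding commutators_def by blast
  then have "c \<cdot>\<^sub>m 1\<^sub>m n = (a \<cdot>\<^sub>m 1\<^sub>m n) * (b \<cdot>\<^sub>m 1\<^sub>m n) - (b \<cdot>\<^sub>m 1\<^sub>m n) * (a \<cdot>\<^sub>m 1\<^sub>m n)"
    unfolding scalar_mat_mult by (auto intro!: eq_matI)
  then show ?thesis using commutatorsI[of "a \<cdot>\<^sub>m 1\<^sub>m n" "carrier_mat n n" "b \<cdot>\<^sub>m 1\<^sub>m n"] by auto
qed

text \<open>For size two a single pivot would be prescribed, and one nonzero element cannot have sum
  zero. Instead the corner is made 0, and the matrix with rows \<open>0, x\<close> and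
  \<open>g, y\<close> is factored directly.\<close>

lemma nonscalar_2x2_prod_commutators:
  fixes A :: "'a::division_ring mat"
  assumes A: "A \<in> carrier_mat 2 2" and ns: "\<forall>z \<in> ring_center. A \<noteq> z \<cdot>\<^sub>m 1\<^sub>m 2"
  shows "\<exists>X \<in> commutators (carrier_mat 2 2). \<exists>Y \<in> commutators (carrier_mat 2 2). A = X * Y"
proof -
  obtain r c B where R: "r \<in> carrier_mat 1 1" "c \<in> carrier_mat 1 1" "B \<in> carrier_mat 1 1"
    "c $$ (0,0) \<noteq> 0" "similar_mat A (four_block_mat (scal 0) r c B)"
    using similar_mat_corner[of A 1 0] A ns by (auto simp: numeral_2_eq_2)
  obtain g x y where g: "g \<noteq> 0" "c = scal g" "r = scal x" "B = scal y"
    using that[OF R(4) scal_conv[OF R(2)] scal_conv[OF R(1)] scal_conv[OF R(3)]] .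
  let ?X = "four_block_mat (0\<^sub>m 1 1) (scal (- x)) (scal g) (0\<^sub>m 1 1)"
  let ?Y = "four_block_mat (scal 1) (scal (inverse g * y)) (0\<^sub>m 1 1) (scal (- 1))"
  let ?E = "four_block_mat (scal 1) (0\<^sub>m 1 1) (0\<^sub>m 1 1) (0\<^sub>m 1 1) :: 'a mat"
  let ?Z = "four_block_mat (0\<^sub>m 1 1) (scal (- x)) (scal (- g)) (0\<^sub>m 1 1)"
  have s0: "0\<^sub>m 1 1 = (scal 0 :: 'a mat)" unfolding scal_def by (rule eq_matI) auto
  have plus: "scal u + scal v = scal (u + v)" for u v :: 'a unfolding scal_def by (rule eq_matI) auto
  have blk: "four_block_mat (scal a1) (scal b1) (scal c1) (scal d1) * four_block_mat (scal a2) (scal b2) (scal c2) (scal d2)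
    = four_block_mat (scal (a1 * a2 + b1 * c2)) (scal (a1 * b2 + b1 * d2)) (scal (c1 * a2 + d1 * c2)) (scal (c1 * b2 + d1 * d2))"
    for a1 b1 c1 d1 a2 b2 c2 d2 :: 'a
    unfolding scal_mult[symmetric] plus[symmetric] by (rule mult_four_block_mat) (rule scal_carrier)+
  have blkm: "four_block_mat (scal a1) (scal b1) (scal c1) (scal d1) - four_block_mat (scal a2) (scal b2) (scal c2) (scal d2)
    = four_block_mat (scal (a1 - a2)) (scal (b1 - b2)) (scal (c1 - c2)) (scal (d1 - d2))"
    for a1 b1 c1 d1 a2 b2 c2 d2 :: 'a
    unfolding scal_minus[symmetric] by (rule minus_four_block_mat) (rule scal_carrier)+
  have XY: "?X * ?Y = four_block_mat (scal 0) r c B"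
    unfolding s0 blk g(2-4) using g(1) by (simp add: mult.assoc[symmetric])
  \<comment> \<open>Commuting with the idempotent \<open>?E\<close> keeps the upper off-diagonal
    entry and negates the lower one, whence the sign of \<open>g\<close> in
    \<open>?Z\<close>.\<close>
  have "?E * ?Z - ?Z * ?E = ?X" unfolding s0 blk blkm by simp
  moreover have "?E \<in> carrier_mat 2 2" "?Z \<in> carrier_mat 2 2" by auto
  ultimately have X: "?X \<in> commutators (carrier_mat 2 2)" using commutatorsI by metis
  have "upper_triangular ?Y"
    by (rule upper_triangular_four_block[of _ 1 _ 1]) (auto intro!: upper_triangularI)
  moreover have "(\<Sum>i<2. ?Y $$ (i,i)) = 0" by (simp add: numeral_2_eq_2)
  moreover have "?Y \<in> carrier_mat 2 2" by auto
  ultimately have "?Y \<in> commutators (carrier_mat 2 2)"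
    using upper_triangular_trace_zero nil_commutators_subset by blast
  then show ?thesis using prod_commutators_similar[OF _ A X] R(5) XY by metis
qed

theorem theorem23:
  fixes n :: nat and A :: "'a::division_ring mat"
  assumes "n \<ge> 2"
    and "(infinite (ring_center :: 'a set) \<or> card (ring_center :: 'a set) \<ge> 3)
         \<or> (card (ring_center :: 'a set) = 2 \<and> odd n)"
    and "\<forall>d::'a. d \<noteq> 0 \<longrightarrow>
           (\<exists>x \<in> noncentral_commutators. \<exists>y \<in> noncentral_commutators. d = x * y)"
    and "A \<in> carrier_mat n n"
  shows "\<exists>X \<in> commutators (carrier_mat n n). \<exists>Y \<in> commutators (carrier_mat n n). A = X * Y"
proof -
  note A = assms(4)
  have prod: "\<exists>x \<in> commutators UNIV. \<exists>y \<in> commutators UNIV. d = x * y" for d :: 'a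
  proof (cases "d = 0")
    case True
    have "0 \<in> commutators (UNIV :: 'a set)" using commutatorsI[of 0 UNIV "0::'a"] by simp
    with True show ?thesis by (intro bexI[of _ 0]) auto
  next
    case False
    then show ?thesis using assms(3) unfolding noncentral_commutators_def by blast
  qed
  show ?thesis
  proof (cases "\<exists>z \<in> ring_center. A = z \<cdot>\<^sub>m 1\<^sub>m n")
    case True
    then obtain z where z: "A = z \<cdot>\<^sub>m 1\<^sub>m n" by blast
    obtain x y where xy: "x \<in> commutators UNIV" "y \<in> commutators UNIV" "z = x * y" using prod by blast
    then show ?thesis
      using z scalar_mat_commutator[of x n] scalar_mat_commutator[of y n] by (metis scalar_mat_mult)
  next
    case False
    then have ns: "\<forall>z \<in> ring_center. A \<noteq> z \<cdot>\<^sub>m 1\<^sub>m n" by blast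
    show ?thesis
    proof (cases "n = 2")
      case True
      then show ?thesis using nonscalar_2x2_prod_commutators A ns by blast
    next
      case False
      \<comment> \<open>There are \<open>n - 1 = k + 2\<close> pivots to prescribe, at least two, so
        they can be nonzero with sum zero.\<close>
      define k where "k = n - 3"
      have n: "n = Suc (Suc (Suc k))" using assms(1) False by (simp add: k_def)
      \<comment> \<open>The hypothesis for \<open>d = 1\<close> provides a noncentral element; it
        differs from the central elements 0 and 1.\<close>
      obtain w :: 'a where "w \<notin> ring_center"
        using assms(3) unfolding noncentral_commutators_def by (metis Diff_iff zero_neq_one)
      then have w: "w \<noteq> 0" "w \<noteq> 1" unfolding ring_center_def by auto
      obtain l where l: "\<forall>i<Suc k. l i \<noteq> 0" "(\<Sum>i<Suc k. l i) = (1::'a)"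
        using nonzero_sequence_sum[OF w, of 1 k] by auto
      \<comment> \<open>The first \<open>k + 1\<close> values have sum 1; the appended
        \<open>- 1\<close> brings the total to 0.\<close>
      define l' where "l' = l(Suc k := - 1)"
      have "(\<Sum>i<Suc k. l' i) = 1" unfolding l(2)[symmetric] l'_def by (intro sum.cong) auto
      then have l0: "(\<Sum>i<Suc (Suc k). l' i) = 0" by (simp add: l'_def)
      have nz: "l' i \<noteq> 0" if "i < Suc (Suc k)" for i using l(1) that by (auto simp: l'_def less_Suc_eq)
      obtain L U where LU: "L \<in> carrier_mat n n" "U \<in> carrier_mat n n" "similar_mat A (L * U)"
        "upper_triangular (transpose_mat L)" "upper_triangular U" "split_trace (Suc (Suc k)) 0 L" "split_trace (Suc (Suc k)) 0 U"
        using similar_lower_upper[of "Suc (Suc k)" l' A, OF prod nz] A ns unfolding l0 n by blast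
      then show ?thesis
        using prod_commutators_similar[OF LU(3) A] lower_triangular_commutator[of L "Suc (Suc k)"]
          upper_triangular_commutator[of U "Suc (Suc k)"] unfolding n by blast
    qed
  qed
qed

end
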